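(* Let $s\ge2$ be an integer, let $G=(\mathbb{Z}/2)^{\ast s}=\langle a_1,\dots,a_s\mid a_1^2=\dots=a_s^2=1\rangle$, and let $\varphi\in\mathrm{Aut}(G)$ be the automorphism $a_i\mapsto a_{i+1}$ (indices modulo $s$). Let $\xi_k$ be the growth function of the corresponding $s$-valued coset group $\mathbb{G}_\varphi(G)$ with respect to the element $g=[a_1,\dots,a_s]$. Then for all integers $k\ge0$ $$\xi_k=\begin{cases}\dfrac{(s-1)^k-1}{s-2}+1, & s\ge3,\\[2mm] k+1, & s=2.\end{cases}$$ In particular, the growth is polynomial if and only if $s=2$.
   Context: Coset group: let $G$ be a group and $\varphi\in\mathrm{Aut}(G)$ an automorphism of finite order $n$. Let $X=G/\langle\varphi\rangle$ be the set of orbits of the cyclic group $\langle\varphi\rangle$ acting on $G$, with quotient map $\pi:G\to X$. The $n$-valued coset group $\mathbb{G}_\varphi(G)$ is the set $X$ with the $n$-valued multiplication $x*y=[\pi(u\,\varphi^i(v)) : 0\le i<n]$ (a multiset of $n$ elements of $X$), where $u\in\pi^{-1}(x)$, $v\in\pi^{-1}(y)$; this is independent of the choice of $u,v$. Its unit is $e=\pi(1)$. Growth function: suppose $\varphi$ cyclically permutes the given generators $f_1,\dots,f_n$ of $G$, and let $g=[f_1,\dots,f_n]\in X$ be their common orbit. Let $g^1$ be the multiset consisting of $g$, and let $g^{k}$ be the multiset union of the multisets $g*x$ for $x$ running over $g^{k-1}$. Then $\xi_k$ ($k\ge0$) is the number of distinct elements of $X$ in $\{e\}\cup g\cup g^2\cup\dots\cup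 g^k$. Polynomial growth means that $\xi_k\le C(k+1)^d$ for all $k\ge 0$, for some constants $C,d>0$. *)

theory Defs
  imports "HOL-Algebra.Algebra" "HOL-Library.Multiset"
begin

section \<open>Groups given by generators and relators\<close>

text \<open>
  The letter \<open>(x, True)\<close> stands for the generator \<open>x\<close>, and \<open>(x, False)\<close> for its formal inverse.
\<close>

type_synonym 'a word = "('a \<times> bool) list"

definition words :: "'a set \<Rightarrow> 'a word set" where
  "words S = lists (S \<times> UNIV)"

inductive pres_eq :: "'a set \<Rightarrow> 'a word set \<Rightarrow> 'a word \<Rightarrow> 'a word \<Rightarrow> bool" for S R where
  refl: "w \<in> words S \<Longrightarrow> pres_eq S R w w"
| sym: "pres_eq S R u v \<Longrightarrow> pres_eq S R v u"
| trans: "pres_eq S R u v \<Longrightarrow> pres_eq S R v w \<Longrightarrow> pres_eq S R u w"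
| append: "pres_eq S R u u' \<Longrightarrow> pres_eq S R v v' \<Longrightarrow> pres_eq S R (u @ v) (u' @ v')"
| cancel: "x \<in> S \<Longrightarrow> pres_eq S R [(x, b), (x, \<not> b)] []"
| relator: "r \<in> R \<Longrightarrow> r \<in> words S \<Longrightarrow> pres_eq S R r []"

definition pres_rel :: "'a set \<Rightarrow> 'a word set \<Rightarrow> ('a word \<times> 'a word) set" where
  "pres_rel S R = {(u, v). pres_eq S R u v}"

definition word_class :: "'a set \<Rightarrow> 'a word set \<Rightarrow> 'a word \<Rightarrow> 'a word set" where
  "word_class S R w = pres_rel S R `` {w}"

definition presented_group :: "'a set \<Rightarrow> 'a word set \<Rightarrow> 'a word set monoid" where
  "presented_group S R =
    \<lparr>carrier = words S // pres_rel S R,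
     monoid.mult = (\<lambda>A B. \<Union>u\<in>A. \<Union>v\<in>B. word_class S R (u @ v)),
     one = word_class S R []\<rparr>"

lemma pres_eq_words: "pres_eq S R u v \<Longrightarrow> u \<in> words S \<and> v \<in> words S"
  by (induction rule: pres_eq.induct) (auto simp: words_def)

lemma equiv_pres_rel: "equiv (words S) (pres_rel S R)"
  by (rule equivI)
    (auto simp: pres_rel_def refl_on_def sym_def trans_def dest: pres_eq_words
      intro: pres_eq.intros)

lemma word_class_eq_iff:
  "u \<in> words S \<Longrightarrow> v \<in> words S \<Longrightarrow> word_class S R u = word_class S R v \<longleftrightarrow> pres_eq S R u v"
  using eq_equiv_class_iff[OF equiv_pres_rel, of u S v R]
  by (simp add: word_class_def pres_rel_def)

lemma carrier_presented_group: "carrier (presented_group S R) = word_class S R ` words S"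
  by (auto simp: presented_group_def quotient_def word_class_def)

lemma one_presented_group: "\<one>\<^bsub>presented_group S R\<^esub> = word_class S R []"
  by (simp add: presented_group_def)

lemma mem_word_class: "u \<in> word_class S R w \<longleftrightarrow> pres_eq S R w u"
  by (simp add: word_class_def pres_rel_def)

lemma append_words: "u \<in> words S \<Longrightarrow> v \<in> words S \<Longrightarrow> u @ v \<in> words S"
  by (auto simp: words_def)

lemma Nil_words: "[] \<in> words S"
  by (auto simp: words_def)

lemma mult_presented_group:
  assumes "u \<in> words S" "v \<in> words S"
  shows "word_class S R u \<otimes>\<^bsub>presented_group S R\<^esub> word_class S R v = word_class S R (u @ v)"
proof -
  have "word_class S R (u' @ v') = word_class S R (u @ v)"
    if "u' \<in> word_class S R u" "v' \<in> word_class S R v" for u' v'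
  proof -
    have p: "pres_eq S R (u @ v) (u' @ v')"
      using that unfolding mem_word_class by (rule pres_eq.append)
    then show ?thesis
      using pres_eq_words[OF p] pres_eq.sym[OF p] by (simp add: word_class_eq_iff)
  qed
  moreover have "u \<in> word_class S R u" "v \<in> word_class S R v"
    using assms by (simp_all add: mem_word_class pres_eq.refl)
  ultimately have "(\<Union>u'\<in>word_class S R u. \<Union>v'\<in>word_class S R v. word_class S R (u' @ v')) =
      word_class S R (u @ v)"
    by blast
  then show ?thesis
    by (simp add: presented_group_def)
qed

lemma inverse_words: "w \<in> words S \<Longrightarrow> rev (map (\<lambda>(x, b). (x, \<not> b)) w) \<in> words S"
  by (induction w) (auto simp: words_def)

lemma pres_eq_inverse:
  "w \<in> words S \<Longrightarrow> pres_eq S R (rev (map (\<lambda>(x, b). (x, \<not> b)) w) @ w) []"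
proof (induction w)
  case Nil
  then show ?case by (auto intro: pres_eq.refl Nil_words)
next
  case (Cons l w)
  obtain x b where l: "l = (x, b)" by (cases l)
  have x: "x \<in> S" and w: "w \<in> words S" using Cons.prems l by (auto simp: words_def)
  have w': "rev (map (\<lambda>(x, b). (x, \<not> b)) w) \<in> words S"
    using w by (rule inverse_words)
  have "pres_eq S R ([(x, \<not> b), (x, \<not> \<not> b)] @ w) ([] @ w)"
    using x w by (intro pres_eq.append pres_eq.cancel pres_eq.refl)
  then have step: "pres_eq S R (rev (map (\<lambda>(x, b). (x, \<not> b)) w) @ [(x, \<not> b), (x, b)] @ w)
      (rev (map (\<lambda>(x, b). (x, \<not> b)) w) @ w)"
    using w' by (intro pres_eq.append pres_eq.refl) auto
  then show ?case
    using pres_eq.trans[OF step Cons.IH[OF w]] l by simp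
qed

lemma group_presented_group: "group (presented_group S R)"
proof (rule groupI)
  fix x assume "x \<in> carrier (presented_group S R)"
  then obtain w where w: "w \<in> words S" "x = word_class S R w"
    by (auto simp: carrier_presented_group)
  have w': "rev (map (\<lambda>(x, b). (x, \<not> b)) w) \<in> words S"
    using w(1) by (rule inverse_words)
  have "word_class S R (rev (map (\<lambda>(x, b). (x, \<not> b)) w) @ w) = word_class S R []"
    using pres_eq_inverse[OF w(1), of R] w w' 
    by (auto simp: word_class_eq_iff append_words Nil_words)
  with w w' show "\<exists>y\<in>carrier (presented_group S R). y \<otimes>\<^bsub>presented_group S R\<^esub> x = \<one>\<^bsub>presented_group S R\<^esub>"
    by (auto simp: carrier_presented_group mult_presented_group one_presented_group)
qed (auto simp: carrier_presented_group one_presented_group mult_presented_group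
    append_words Nil_words)

lemma presented_auto_eqI:
  assumes f: "f \<in> auto (presented_group S R)" and h: "h \<in> auto (presented_group S R)"
    and eq: "\<And>x. x \<in> S \<Longrightarrow> f (word_class S R [(x, True)]) = h (word_class S R [(x, True)])"
  shows "f = h"
proof -
  let ?P = "presented_group S R" and ?c = "word_class S R"
  interpret group ?P by (rule group_presented_group)
  interpret f: group_hom ?P ?P f
    using f group_presented_group by (simp add: group_hom_def group_hom_axioms_def auto_def)
  interpret h: group_hom ?P ?P h
    using h group_presented_group by (simp add: group_hom_def group_hom_axioms_def auto_def)
  have letter: "f (?c [(x, b)]) = h (?c [(x, b)])" if x: "x \<in> S" for x b
  proof (cases b)
    case True
    then show ?thesis using eq x by simp
  next
    case False
    have w: "[(x, True)] \<in> words S" "[(x, False)] \<in> words S"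
      using x by (auto simp: words_def)
    have "?c [(x, False), (x, True)] = ?c []"
      using x w pres_eq.cancel[OF x, of R False]
      by (subst word_class_eq_iff) (auto simp: words_def)
    then have "?c [(x, False)] \<otimes>\<^bsub>?P\<^esub> ?c [(x, True)] = \<one>\<^bsub>?P\<^esub>"
      using w by (simp add: mult_presented_group one_presented_group)
    moreover have carr: "?c [(x, True)] \<in> carrier ?P" "?c [(x, False)] \<in> carrier ?P"
      using w by (auto simp: carrier_presented_group)
    ultimately have "inv\<^bsub>?P\<^esub> (?c [(x, True)]) = ?c [(x, False)]"
      by (rule inv_equality)
    then show ?thesis
      using f.hom_inv[OF carr(1)] h.hom_inv[OF carr(1)] eq[OF x] False by simp
  qed
  have "f (?c w) = h (?c w)" if "w \<in> words S" for w
    using that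
  proof (induction w)
    case Nil
    then show ?case
      using f.hom_one h.hom_one by (simp add: one_presented_group)
  next
    case (Cons l w)
    have w: "[l] \<in> words S" "w \<in> words S" and l: "fst l \<in> S"
      using Cons.prems by (auto simp: words_def)
    have c: "?c (l # w) = ?c [l] \<otimes>\<^bsub>?P\<^esub> ?c w"
      using mult_presented_group[OF w, of R] by simp
    have carr: "?c [l] \<in> carrier ?P" "?c w \<in> carrier ?P"
      using w by (auto simp: carrier_presented_group)
    show ?case
      unfolding c using f.hom_mult[OF carr] h.hom_mult[OF carr] Cons.IH[OF w(2)]
        letter[OF l, of "snd l"] by simp
  qed
  moreover have "f \<in> extensional (carrier ?P)" "h \<in> extensional (carrier ?P)"
    using f h by (auto simp: auto_def Bij_def)
  ultimately show ?thesis
    by (intro extensionalityI[of f "carrier ?P" h]) (auto simp: carrier_presented_group)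
qed

lemma relabel_words:
  "w \<in> words S \<Longrightarrow> \<sigma> ` S \<subseteq> S \<Longrightarrow> map (map_prod \<sigma> id) w \<in> words S"
  by (induction w) (auto simp: words_def)

lemma pres_eq_relabel:
  assumes "pres_eq S R u v" and "\<sigma> ` S \<subseteq> S" and "map (map_prod \<sigma> id) ` R \<subseteq> R"
  shows "pres_eq S R (map (map_prod \<sigma> id) u) (map (map_prod \<sigma> id) v)"
  using assms(1)
proof induction
  case (refl w)
  then have "map (map_prod \<sigma> id) w \<in> words S"
    using assms(2) by (rule relabel_words)
  then show ?case by (rule pres_eq.refl)
next
  case (sym u v)
  show ?case by (rule pres_eq.sym) (rule sym.IH)
next
  case (trans u v w)
  then show ?case by (auto intro: pres_eq.trans)
next
  case (append u u' v v')
  then show ?case by (auto intro: pres_eq.append)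
next
  case (cancel x b)
  then show ?case using assms(2) by (auto intro: pres_eq.cancel)
next
  case (relator r)
  from relator(2) have "map (map_prod \<sigma> id) r \<in> words S"
    using assms(2) by (rule relabel_words)
  moreover have "map (map_prod \<sigma> id) r \<in> R"
    using relator assms(3) by blast
  ultimately show ?case
    unfolding list.map(1) by (intro pres_eq.relator)
qed

lemma presented_relabel_auto:
  assumes \<sigma>: "\<sigma> ` S \<subseteq> S" "map (map_prod \<sigma> id) ` R \<subseteq> R"
    and \<tau>: "\<tau> ` S \<subseteq> S" "map (map_prod \<tau> id) ` R \<subseteq> R"
    and inv: "\<And>x. x \<in> S \<Longrightarrow> \<tau> (\<sigma> x) = x" "\<And>x. x \<in> S \<Longrightarrow> \<sigma> (\<tau> x) = x"
  obtains f where "f \<in> auto (presented_group S R)"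
    and "\<And>x. x \<in> S \<Longrightarrow> f (word_class S R [(x, True)]) = word_class S R [(\<sigma> x, True)]"
proof -
  let ?P = "presented_group S R" and ?c = "word_class S R"
  define F where "F = (\<lambda>\<rho> A. ?c (map (map_prod \<rho> id) (SOME w. w \<in> words S \<and> ?c w = A)))"
  have F: "F \<rho> (?c w) = ?c (map (map_prod \<rho> id) w) \<and> map (map_prod \<rho> id) w \<in> words S"
    if "\<rho> ` S \<subseteq> S" "map (map_prod \<rho> id) ` R \<subseteq> R" "w \<in> words S" for \<rho> w
  proof -
    define v where "v = (SOME v. v \<in> words S \<and> ?c v = ?c w)"
    have "v \<in> words S \<and> ?c v = ?c w"
      unfolding v_def by (rule someI[of _ w]) (use that in simp)
    then have "pres_eq S R v w" using that word_class_eq_iff by blast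
    then have p: "pres_eq S R (map (map_prod \<rho> id) v) (map (map_prod \<rho> id) w)"
      using that pres_eq_relabel by blast
    then show ?thesis
      using pres_eq_words[OF p] word_class_eq_iff[of "map (map_prod \<rho> id) v" S "map (map_prod \<rho> id) w" R]
      by (auto simp: F_def v_def)
  qed
  have cancel: "map (map_prod \<beta> id) (map (map_prod \<alpha> id) w) = w"
    if "w \<in> words S" "\<And>x. x \<in> S \<Longrightarrow> \<beta> (\<alpha> x) = x" for \<alpha> \<beta> :: "'a \<Rightarrow> 'a" and w
    using that by (induction w) (auto simp: words_def)
  define f where "f = restrict (F \<sigma>) (carrier ?P)"
  have f: "f (?c w) = ?c (map (map_prod \<sigma> id) w)" if "w \<in> words S" for w
    using F[OF \<sigma> that] that by (simp add: f_def carrier_presented_group)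
  have "bij_betw f (carrier ?P) (carrier ?P)"
  proof (rule bij_betw_byWitness[where f' = "F \<tau>"])
    show "\<forall>A\<in>carrier ?P. F \<tau> (f A) = A"
      using f F[OF \<sigma>] F[OF \<tau>] cancel[where \<alpha> = \<sigma> and \<beta> = \<tau>, OF _ inv(1)] by (auto simp: carrier_presented_group)
    show "\<forall>A\<in>carrier ?P. f (F \<tau> A) = A"
      using f F[OF \<sigma>] F[OF \<tau>] cancel[where \<alpha> = \<tau> and \<beta> = \<sigma>, OF _ inv(2)] by (auto simp: carrier_presented_group)
    show "f ` carrier ?P \<subseteq> carrier ?P"
      using f F[OF \<sigma>] by (auto simp: carrier_presented_group)
    show "F \<tau> ` carrier ?P \<subseteq> carrier ?P"
      using F[OF \<tau>] by (auto simp: carrier_presented_group)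
  qed
  moreover have "f \<in> hom ?P ?P"
  proof (rule homI)
    show "f A \<in> carrier ?P" if "A \<in> carrier ?P" for A
      using that f F[OF \<sigma>] by (auto simp: carrier_presented_group)
    fix A B assume "A \<in> carrier ?P" "B \<in> carrier ?P"
    then obtain u v where "u \<in> words S" "A = ?c u" "v \<in> words S" "B = ?c v"
      by (auto simp: carrier_presented_group)
    then show "f (A \<otimes>\<^bsub>?P\<^esub> B) = f A \<otimes>\<^bsub>?P\<^esub> f B"
      using f F[OF \<sigma>] by (simp add: mult_presented_group append_words)
  qed
  ultimately have "f \<in> auto ?P"
    by (simp add: auto_def Bij_def f_def)
  moreover have "f (?c [(x, True)]) = ?c [(\<sigma> x, True)]" if "x \<in> S" for x
    using f[of "[(x, True)]"] that by (simp add: words_def)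
  ultimately show ?thesis using that by blast
qed


section \<open>The free product of \<open>s\<close> copies of \<open>\<int>/2\<close>\<close>

text \<open>The generators \<open>a\<^sub>1, \<dots>, a\<^sub>s\<close> are indexed by \<open>0, \<dots>, s - 1\<close>.\<close>

definition Z2_free_power :: "nat \<Rightarrow> nat word set monoid" where
  "Z2_free_power s = presented_group {..<s} {[(i, True), (i, True)] | i. i < s}"

definition Z2_gen :: "nat \<Rightarrow> nat \<Rightarrow> nat word set" where
  "Z2_gen s i = word_class {..<s} {[(i, True), (i, True)] | i. i < s} [(i, True)]"


section \<open>Coset groups\<close>

record 'x nvalued_group = "'x partial_object" +
  nv_mult :: "'x \<Rightarrow> 'x \<Rightarrow> 'x multiset"
  nv_unit :: 'x

definition aut_proj :: "('a, 'b) monoid_scheme \<Rightarrow> ('a \<Rightarrow> 'a) \<Rightarrow> 'a \<Rightarrow> 'a set" where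
  "aut_proj G \<phi> u = orbit (subgroup_generated (AutoGroup G) {\<phi>}) (\<lambda>\<psi>. \<psi>) u"

text \<open>
  Meant for \<open>\<phi>\<close> in \<open>auto G\<close> of finite order; \<open>ord\<close> is \<open>0\<close> for infinite order. The choice of
  representatives in the multiplication is then immaterial, see \<open>coset_group_mult\<close>.
\<close>

definition coset_group :: "('a, 'b) monoid_scheme \<Rightarrow> ('a \<Rightarrow> 'a) \<Rightarrow> 'a set nvalued_group" where
  "coset_group G \<phi> =
    \<lparr>carrier = orbits (subgroup_generated (AutoGroup G) {\<phi>}) (carrier G) (\<lambda>\<psi>. \<psi>),
     nv_mult = (\<lambda>x y.
       let u = (SOME u. u \<in> carrier G \<and> aut_proj G \<phi> u = x);
           v = (SOME v. v \<in> carrier G \<and> aut_proj G \<phi> v = y)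
       in image_mset (\<lambda>i. aut_proj G \<phi> (u \<otimes>\<^bsub>G\<^esub> (\<phi> [^]\<^bsub>AutoGroup G\<^esub> i) v))
            (mset_set {0..<group.ord (AutoGroup G) \<phi>})),
     nv_unit = aut_proj G \<phi> \<one>\<^bsub>G\<^esub>\<rparr>"

text \<open>The zeroth power is a convention only; \<open>nv_growth\<close> starts from the first power.\<close>

fun nv_pow :: "('x, 'b) nvalued_group_scheme \<Rightarrow> 'x \<Rightarrow> nat \<Rightarrow> 'x multiset" where
  "nv_pow N g 0 = {#nv_unit N#}"
| "nv_pow N g (Suc 0) = {#g#}"
| "nv_pow N g (Suc (Suc k)) = (\<Sum>x\<in>#nv_pow N g (Suc k). nv_mult N g x)"

definition nv_growth :: "('x, 'b) nvalued_group_scheme \<Rightarrow> 'x \<Rightarrow> nat \<Rightarrow> nat" where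
  "nv_growth N g k = card ({nv_unit N} \<union> (\<Union>j\<in>{1..k}. set_mset (nv_pow N g j)))"

definition polynomial_growth :: "(nat \<Rightarrow> nat) \<Rightarrow> bool" where
  "polynomial_growth \<xi> \<longleftrightarrow>
    (\<exists>C d :: real. C > 0 \<and> d > 0 \<and> (\<forall>k. real (\<xi> k) \<le> C * (real k + 1) powr d))"

lemma carrier_coset_group: "carrier (coset_group G \<phi>) = aut_proj G \<phi> ` carrier G"
  by (auto simp: coset_group_def orbits_def aut_proj_def)

context group
begin

lemma carrier_AutoGroup: "carrier (AutoGroup G) = auto G"
  by (simp add: AutoGroup_def)

lemma AutoGroup_mult_apply:
  assumes "f \<in> auto G" "h \<in> auto G" "x \<in> carrier G"
  shows "(f \<otimes>\<^bsub>AutoGroup G\<^esub> h) x = f (h x)"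
  using assms by (auto simp: AutoGroup_def BijGroup_def auto_def compose_def)

lemma auto_closed: "f \<in> auto G \<Longrightarrow> x \<in> carrier G \<Longrightarrow> f x \<in> carrier G"
  by (auto simp: auto_def hom_def)

lemma auto_pow_closed: "f \<in> auto G \<Longrightarrow> f [^]\<^bsub>AutoGroup G\<^esub> (i::nat) \<in> auto G"
  using group.is_monoid[OF AutoGroup] monoid.nat_pow_closed carrier_AutoGroup by metis

lemma auto_pow_add:
  assumes "f \<in> auto G" "x \<in> carrier G"
  shows "(f [^]\<^bsub>AutoGroup G\<^esub> (i + j::nat)) x = (f [^]\<^bsub>AutoGroup G\<^esub> i) ((f [^]\<^bsub>AutoGroup G\<^esub> j) x)"
  using assms monoid.nat_pow_mult[OF group.is_monoid[OF AutoGroup], of f i j]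
  by (metis AutoGroup_mult_apply auto_pow_closed carrier_AutoGroup)

lemma auto_pow_mod:
  assumes "f \<in> auto G"
  shows "f [^]\<^bsub>AutoGroup G\<^esub> (i mod group.ord (AutoGroup G) f) = f [^]\<^bsub>AutoGroup G\<^esub> (i::nat)"
proof -
  interpret A: group "AutoGroup G" by (rule AutoGroup)
  have f: "f \<in> carrier (AutoGroup G)" using assms by (simp add: carrier_AutoGroup)
  have "i = A.ord f * (i div A.ord f) + i mod A.ord f" by simp
  then have "f [^]\<^bsub>AutoGroup G\<^esub> i = f [^]\<^bsub>AutoGroup G\<^esub> (A.ord f * (i div A.ord f)) \<otimes>\<^bsub>AutoGroup G\<^esub> f [^]\<^bsub>AutoGroup G\<^esub> (i mod A.ord f)"
    using f by (metis A.nat_pow_mult)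
  also have "f [^]\<^bsub>AutoGroup G\<^esub> (A.ord f * (i div A.ord f)) = \<one>\<^bsub>AutoGroup G\<^esub>"
    using f A.pow_eq_id by simp
  finally show ?thesis using f by simp
qed

lemma aut_proj_eq:
  assumes f: "f \<in> auto G" and n: "group.ord (AutoGroup G) f > 0" and x: "x \<in> carrier G"
  shows "aut_proj G f x = range (\<lambda>i::nat. (f [^]\<^bsub>AutoGroup G\<^esub> i) x)"
proof -
  interpret A: group "AutoGroup G" by (rule AutoGroup)
  have fA: "f \<in> carrier (AutoGroup G)" using f by (simp add: carrier_AutoGroup)
  have reduce: "f [^]\<^bsub>AutoGroup G\<^esub> k = f [^]\<^bsub>AutoGroup G\<^esub> nat (k mod int (A.ord f))" for k :: int
  proof -
    have "int (A.ord f) dvd (int (nat (k mod int (A.ord f))) - k)"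
      using n by (simp add: mod_eq_dvd_iff[symmetric])
    then have "f [^]\<^bsub>AutoGroup G\<^esub> k = f [^]\<^bsub>AutoGroup G\<^esub> int (nat (k mod int (A.ord f)))"
      by (simp only: A.int_pow_eq[OF fA])
    then show ?thesis
      by (simp only: int_pow_int)
  qed
  have "generate (AutoGroup G) {f} = range (\<lambda>k::int. f [^]\<^bsub>AutoGroup G\<^esub> k)"
    using A.generate_pow[OF fA] by (simp only: full_SetCompr_eq UNIV_I simp_thms)
  also have "\<dots> = range (\<lambda>i::nat. f [^]\<^bsub>AutoGroup G\<^esub> i)"
  proof (intro equalityI image_subsetI)
    show "f [^]\<^bsub>AutoGroup G\<^esub> k \<in> range (\<lambda>i::nat. f [^]\<^bsub>AutoGroup G\<^esub> i)" for k :: int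
      unfolding reduce[of k] by (rule rangeI)
    show "f [^]\<^bsub>AutoGroup G\<^esub> i \<in> range (\<lambda>k::int. f [^]\<^bsub>AutoGroup G\<^esub> k)" for i :: nat
      using rangeI[of "\<lambda>k::int. f [^]\<^bsub>AutoGroup G\<^esub> k" "int i"] by (simp only: int_pow_int)
  qed
  finally have gen: "generate (AutoGroup G) {f} = range (\<lambda>i::nat. f [^]\<^bsub>AutoGroup G\<^esub> i)" .
  have "carrier (AutoGroup G) \<inter> {f} = {f}" using fA by blast
  then show ?thesis
    unfolding aut_proj_def orbit_def carrier_subgroup_generated by (simp only: gen) blast
qed

lemma aut_proj_pow:
  assumes f: "f \<in> auto G" and n: "group.ord (AutoGroup G) f > 0" and x: "x \<in> carrier G"
  shows "aut_proj G f ((f [^]\<^bsub>AutoGroup G\<^esub> (i::nat)) x) = aut_proj G f x"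
proof -
  interpret A: group "AutoGroup G" by (rule AutoGroup)
  let ?n = "A.ord f"
  have "\<exists>k. (f [^]\<^bsub>AutoGroup G\<^esub> j) x = (f [^]\<^bsub>AutoGroup G\<^esub> (k + i)) x" for j :: nat
  proof
    have "(j + ?n * i - i + i) mod ?n = j mod ?n"
      using n by (simp add: trans_le_add2)
    then show "(f [^]\<^bsub>AutoGroup G\<^esub> j) x = (f [^]\<^bsub>AutoGroup G\<^esub> (j + ?n * i - i + i)) x"
      using auto_pow_mod[OF f] by metis
  qed
  moreover have "(f [^]\<^bsub>AutoGroup G\<^esub> i) x \<in> carrier G"
    using auto_closed auto_pow_closed f x by blast
  ultimately show ?thesis
    using f n x by (auto simp: aut_proj_eq auto_pow_add[symmetric])
qed

lemma coset_group_mult: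
  assumes f: "f \<in> auto G" and n: "group.ord (AutoGroup G) f > 0"
    and u: "u \<in> carrier G" and v: "v \<in> carrier G"
  shows "nv_mult (coset_group G f) (aut_proj G f u) (aut_proj G f v) =
    image_mset (\<lambda>i. aut_proj G f (u \<otimes> (f [^]\<^bsub>AutoGroup G\<^esub> i) v))
      (mset_set {0..<group.ord (AutoGroup G) f})"
proof -
  interpret A: group "AutoGroup G" by (rule AutoGroup)
  let ?n = "A.ord f" and ?p = "\<lambda>i::nat. f [^]\<^bsub>AutoGroup G\<^esub> i" and ?\<pi> = "aut_proj G f"
  define u' where "u' = (SOME w. w \<in> carrier G \<and> ?\<pi> w = ?\<pi> u)"
  define v' where "v' = (SOME w. w \<in> carrier G \<and> ?\<pi> w = ?\<pi> v)"
  have u': "u' \<in> carrier G" "?\<pi> u' = ?\<pi> u"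
    unfolding u'_def using someI[of "\<lambda>w. w \<in> carrier G \<and> ?\<pi> w = ?\<pi> u" u] u by auto
  have v': "v' \<in> carrier G" "?\<pi> v' = ?\<pi> v"
    unfolding v'_def using someI[of "\<lambda>w. w \<in> carrier G \<and> ?\<pi> w = ?\<pi> v" v] v by auto
  have self: "w \<in> ?\<pi> w" if "w \<in> carrier G" for w
  proof -
    have "?p 0 w = w" using that by (simp add: AutoGroup_def BijGroup_def)
    then show ?thesis unfolding aut_proj_eq[OF f n that] by (intro range_eqI[of _ _ 0]) simp
  qed
  obtain a where a: "u' = ?p a u" using self[OF u'(1)] u' aut_proj_eq[OF f n u] by auto
  obtain b where b: "v' = ?p b v" using self[OF v'(1)] v' aut_proj_eq[OF f n v] by auto
  define c where "c = b + (?n * a - a)"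
  have step: "?\<pi> (u' \<otimes> ?p i v') = ?\<pi> (u \<otimes> ?p ((i + c) mod ?n) v)" for i
  proof -
    have a_le: "a \<le> ?n * a"
      using n by (cases ?n) auto
    have pc: "?p j w \<in> carrier G" if "w \<in> carrier G" for j w
      using that auto_closed auto_pow_closed f by blast
    have "?p a (u \<otimes> ?p (i + c) v) = ?p a u \<otimes> ?p a (?p (i + c) v)"
      using auto_pow_closed[OF f, of a] u pc[OF v] by (auto simp: auto_def hom_def)
    also have "?p a (?p (i + c) v) = ?p (a + (i + c)) v"
      using f v by (simp add: auto_pow_add)
    also have "a + (i + c) = i + b + ?n * a"
      using a_le unfolding c_def by linarith
    also have "?p (i + b + ?n * a) = ?p (i + b)"
      using auto_pow_mod[OF f] by (metis mod_mult_self2)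
    also have "?p (i + b) v = ?p i v'"
      using f v b by (simp add: auto_pow_add)
    finally have "?p a (u \<otimes> ?p (i + c) v) = u' \<otimes> ?p i v'" using a by simp
    then show ?thesis
      using aut_proj_pow[OF f n, of "u \<otimes> ?p (i + c) v" a] u pc[OF v] auto_pow_mod[OF f, of "i + c"]
      by simp
  qed
  have inj: "inj_on (\<lambda>i. (i + c) mod ?n) {0..<?n}"
  proof (rule inj_onI)
    fix i j assume ij: "i \<in> {0..<?n}" "j \<in> {0..<?n}" "(i + c) mod ?n = (j + c) mod ?n"
    then have "(i + c + (?n * c - c)) mod ?n = (j + c + (?n * c - c)) mod ?n"
      by (metis mod_add_left_eq)
    moreover have "c \<le> ?n * c"
      using n by (cases ?n) auto
    ultimately have "(i + ?n * c) mod ?n = (j + ?n * c) mod ?n"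
      by (simp only: add.assoc le_add_diff_inverse)
    then show "i = j" using ij by simp
  qed
  have im: "(\<lambda>i. (i + c) mod ?n) ` {0..<?n} = {0..<?n}"
    using n inj by (intro card_subset_eq) (auto simp: card_image)
  have "nv_mult (coset_group G f) (?\<pi> u) (?\<pi> v) =
      image_mset (\<lambda>i. ?\<pi> (u' \<otimes> ?p i v')) (mset_set {0..<?n})"
    by (simp add: coset_group_def Let_def u'_def v'_def)
  also have "\<dots> = image_mset (\<lambda>i. ?\<pi> (u \<otimes> ?p i v)) (image_mset (\<lambda>i. (i + c) mod ?n) (mset_set {0..<?n}))"
    using step by (simp add: multiset.map_comp comp_def)
  also have "image_mset (\<lambda>i. (i + c) mod ?n) (mset_set {0..<?n}) = mset_set {0..<?n}"
    using image_mset_mset_set[OF inj] im by simp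
  finally show ?thesis .
qed

end

section \<open>The cyclic shift of the generators\<close>

text \<open>
  The automorphism permuting the generators cyclically exists and is unique; it has order \<open>s\<close>, and
  the generators form one of its orbits.
\<close>

lemma Z2_auto_eqI:
  "f \<in> auto (Z2_free_power s) \<Longrightarrow> h \<in> auto (Z2_free_power s) \<Longrightarrow>
    (\<And>i. i < s \<Longrightarrow> f (Z2_gen s i) = h (Z2_gen s i)) \<Longrightarrow> f = h"
  unfolding Z2_free_power_def Z2_gen_def by (rule presented_auto_eqI) auto

lemma Z2_shift_ex1:
  "\<exists>!\<phi>. \<phi> \<in> auto (Z2_free_power s) \<and> (\<forall>i<s. \<phi> (Z2_gen s i) = Z2_gen s ((i + 1) mod s))"
proof -
  let ?R = "{[(i, True), (i, True)] | i. i < s}"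
  obtain f where "f \<in> auto (presented_group {..<s} ?R)"
    and "\<And>i. i \<in> {..<s} \<Longrightarrow>
      f (word_class {..<s} ?R [(i, True)]) = word_class {..<s} ?R [((i + 1) mod s, True)]"
  proof (rule presented_relabel_auto[of "\<lambda>i. (i + 1) mod s" "{..<s}" ?R "\<lambda>i. (i + (s - 1)) mod s"])
    show "((i + 1) mod s + (s - 1)) mod s = i" "((i + (s - 1)) mod s + 1) mod s = i"
      if "i \<in> {..<s}" for i
      using that by (simp_all only: mod_add_left_eq add.assoc) simp_all
  qed auto
  then have "f \<in> auto (Z2_free_power s) \<and> (\<forall>i<s. f (Z2_gen s i) = Z2_gen s ((i + 1) mod s))"
    by (simp add: Z2_free_power_def Z2_gen_def)
  moreover have "g = h"
    if "g \<in> auto (Z2_free_power s) \<and> (\<forall>i<s. g (Z2_gen s i) = Z2_gen s ((i + 1) mod s))"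
      "h \<in> auto (Z2_free_power s) \<and> (\<forall>i<s. h (Z2_gen s i) = Z2_gen s ((i + 1) mod s))" for g h
    using that by (intro Z2_auto_eqI[of g s h]) auto
  ultimately show ?thesis by blast
qed

lemma Z2_gen_inj:
  assumes "i < s" "j < s" "Z2_gen s i = Z2_gen s j"
  shows "i = j"
proof -
  let ?R = "{[(i, True), (i, True)] | i. i < s}"
  have parity: "even (length (filter (\<lambda>l. fst l = i) u)) = even (length (filter (\<lambda>l. fst l = i) v))"
    if "pres_eq {..<s} ?R u v" for u v
    using that by induction auto
  have "pres_eq {..<s} ?R [(i, True)] [(j, True)]"
    using assms word_class_eq_iff[of "[(i, True)]" "{..<s}" "[(j, True)]" ?R]
    by (simp add: Z2_gen_def words_def)
  from parity[OF this] show ?thesis by (auto split: if_splits)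
qed

context
  fixes s :: nat and \<phi> :: "nat word set \<Rightarrow> nat word set"
  assumes s: "s \<ge> 1"
    and auto: "\<phi> \<in> auto (Z2_free_power s)"
    and shift: "\<And>i. i < s \<Longrightarrow> \<phi> (Z2_gen s i) = Z2_gen s ((i + 1) mod s)"
begin

interpretation group "Z2_free_power s"
  by (simp add: Z2_free_power_def group_presented_group)

interpretation A: group "AutoGroup (Z2_free_power s)"
  by (rule AutoGroup)

lemma Z2_gen_carrier: "i < s \<Longrightarrow> Z2_gen s i \<in> carrier (Z2_free_power s)"
  by (auto simp: Z2_free_power_def Z2_gen_def carrier_presented_group words_def)

lemma Z2_shift_pow:
  assumes "i < s"
  shows "(\<phi> [^]\<^bsub>AutoGroup (Z2_free_power s)\<^esub> (k::nat)) (Z2_gen s i) = Z2_gen s ((i + k) mod s)"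
proof (induction k)
  case 0
  then show ?case
    using assms Z2_gen_carrier by (simp add: AutoGroup_def BijGroup_def)
next
  case (Suc k)
  have "(\<phi> [^]\<^bsub>AutoGroup (Z2_free_power s)\<^esub> Suc k) (Z2_gen s i) =
      (\<phi> [^]\<^bsub>AutoGroup (Z2_free_power s)\<^esub> (1 + k)) (Z2_gen s i)"
    by simp
  also have "\<dots> = \<phi> (Z2_gen s ((i + k) mod s))"
    using auto_pow_add[OF auto Z2_gen_carrier[OF assms], of 1 k] Suc auto
    by (simp add: carrier_AutoGroup)
  also have "\<dots> = Z2_gen s ((i + Suc k) mod s)"
    using shift[of "(i + k) mod s"] s by (simp add: mod_simps)
  finally show ?case .
qed

lemma Z2_shift_ord: "group.ord (AutoGroup (Z2_free_power s)) \<phi> = s"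
proof -
  have \<phi>: "\<phi> \<in> carrier (AutoGroup (Z2_free_power s))"
    using auto by (simp add: carrier_AutoGroup)
  have one: "\<one>\<^bsub>AutoGroup (Z2_free_power s)\<^esub> \<in> auto (Z2_free_power s)"
    using A.one_closed by (simp only: carrier_AutoGroup)
  have one_apply: "\<one>\<^bsub>AutoGroup (Z2_free_power s)\<^esub> (Z2_gen s i) = Z2_gen s i" if "i < s" for i
    using Z2_gen_carrier[OF that] by (simp add: AutoGroup_def BijGroup_def)
  have "(\<phi> [^]\<^bsub>AutoGroup (Z2_free_power s)\<^esub> k = \<one>\<^bsub>AutoGroup (Z2_free_power s)\<^esub>) = (s dvd k)" for k :: nat
  proof
    assume k: "\<phi> [^]\<^bsub>AutoGroup (Z2_free_power s)\<^esub> k = \<one>\<^bsub>AutoGroup (Z2_free_power s)\<^esub>"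
    have "0 < s" using s by simp
    from Z2_shift_pow[OF this, of k] one_apply[OF this] have "Z2_gen s (k mod s) = Z2_gen s 0"
      unfolding k by simp
    then have "k mod s = 0"
      using Z2_gen_inj[of "k mod s" s 0] \<open>0 < s\<close> by simp
    then show "s dvd k" by (rule mod_0_imp_dvd)
  next
    assume k: "s dvd k"
    show "\<phi> [^]\<^bsub>AutoGroup (Z2_free_power s)\<^esub> k = \<one>\<^bsub>AutoGroup (Z2_free_power s)\<^esub>"
    proof (rule Z2_auto_eqI[OF auto_pow_closed[OF auto] one])
      fix i assume i: "i < s"
      have "(i + k) mod s = i"
        using k i by (metis dvd_imp_mod_0 add.right_neutral mod_add_right_eq mod_less)
      then show "(\<phi> [^]\<^bsub>AutoGroup (Z2_free_power s)\<^esub> k) (Z2_gen s i) = \<one>\<^bsub>AutoGroup (Z2_free_power s)\<^esub> (Z2_gen s i)"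
        by (simp only: Z2_shift_pow[OF i] one_apply[OF i])
    qed
  qed
  then show ?thesis using A.ord_unique[OF \<phi>] by blast
qed

lemma Z2_gen_orbit:
  assumes "i < s"
  shows "aut_proj (Z2_free_power s) \<phi> (Z2_gen s i) = {Z2_gen s j | j. j < s}"
proof -
  have "aut_proj (Z2_free_power s) \<phi> (Z2_gen s i) = range (\<lambda>k. Z2_gen s ((i + k) mod s))"
    using aut_proj_eq[OF auto _ Z2_gen_carrier[OF assms]] Z2_shift_ord s
    by (simp add: Z2_shift_pow[OF assms])
  also have "\<dots> = {Z2_gen s j | j. j < s}"
  proof (intro equalityI subsetI)
    fix A assume "A \<in> range (\<lambda>k. Z2_gen s ((i + k) mod s))"
    then obtain k where "A = Z2_gen s ((i + k) mod s)" by blast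
    moreover have "(i + k) mod s < s" using s by simp
    ultimately show "A \<in> {Z2_gen s j | j. j < s}" by blast
  next
    fix A assume "A \<in> {Z2_gen s j | j. j < s}"
    then obtain j where j: "A = Z2_gen s j" "j < s" by blast
    have "(i + (j + s - i)) mod s = j" using j assms by simp
    then show "A \<in> range (\<lambda>k. Z2_gen s ((i + k) mod s))"
      using j(1) by (intro range_eqI[of _ _ "j + s - i"]) simp
  qed
  finally show ?thesis .
qed

end

end

theory Submission
  imports Defs "HOL-Real_Asymp.Real_Asymp"
begin

text \<open>
  By the normal form theorem every element of the free product is a unique word without equal
  adjacent letters. The shift acts freely on nonempty reduced words, and each of their orbits
  contains exactly one word beginning with \<open>a\<^sub>1\<close>; so there are \<open>(s - 1)\<^sup>m\<close> orbits of words of length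
  \<open>m + 1\<close>. Multiplying an orbit by \<open>g\<close> prepends \<open>a\<^sub>1\<close> to all shifts of a word; this yields every
  orbit of words that are longer by one letter, and, if the letters cancel, the orbit of a shorter word.
\<close>

section \<open>Action of the generators on reduced words and uniqueness of normal forms\<close>

definition cancel_cons :: "'a \<Rightarrow> 'a list \<Rightarrow> 'a list" where
  "cancel_cons x w = (case w of [] \<Rightarrow> [x] | y # v \<Rightarrow> if x = y then v else x # w)"

lemma distinct_adj_cancel_cons: "distinct_adj w \<Longrightarrow> distinct_adj (cancel_cons x w)"
  by (auto simp: cancel_cons_def distinct_adj_Cons split: list.splits)

lemma set_cancel_cons: "set (cancel_cons x w) \<subseteq> insert x (set w)"
  by (auto simp: cancel_cons_def split: list.splits)

lemma length_cancel_cons: "length (cancel_cons x w) \<le> Suc (length w)"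
  by (auto simp: cancel_cons_def split: list.splits)

text \<open>The relation \<open>x\<^sup>2 = 1\<close> for the action on reduced words. On a word
  \<open>x # x # v\<close> it would fail, since two letters would be removed.\<close>

lemma cancel_cons_twice: "distinct_adj w \<Longrightarrow> cancel_cons x (cancel_cons x w) = w"
  by (auto simp: cancel_cons_def distinct_adj_Cons split: list.splits)

lemma foldr_cancel_cons_distinct_adj: "distinct_adj w \<Longrightarrow> foldr cancel_cons w [] = w"
  by (induction w) (auto simp: cancel_cons_def distinct_adj_Cons split: list.splits)

text \<open>Van der Waerden's argument: each generator acts on reduced words as an involution. A
  formal inverse thus acts like the letter itself, which is why only \<open>fst l\<close> enters,
  and relators and cancelling pairs act trivially.\<close>

lemma pres_eq_foldr_cancel_cons:
  assumes "pres_eq S {[(i, True), (i, True)] | i. i \<in> S} u v" "distinct_adj w"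
  shows "foldr (\<lambda>l. cancel_cons (fst l)) u w = foldr (\<lambda>l. cancel_cons (fst l)) v w"
proof -
  \<comment> \<open>In the \<open>append\<close> case the second factor acts first; its result must
    be reduced before the induction hypothesis applies to the first factor.\<close>
  have da: "distinct_adj (foldr (\<lambda>l. cancel_cons (fst l)) u w)"
    if "distinct_adj w" for u :: "('a \<times> bool) list" and w
    using that by (induction u) (auto intro: distinct_adj_cancel_cons)
  show ?thesis
    using assms
    by (induction arbitrary: w rule: pres_eq.induct) (auto simp: cancel_cons_twice da)
qed

section \<open>Counting reduced words with a prescribed first letter\<close>

definition reduced_words :: "'a set \<Rightarrow> 'a list set" where
  "reduced_words A = {w. set w \<subseteq> A \<and> distinct_adj w}"

lemma cancel_cons_reduced_words:
  "x \<in> A \<Longrightarrow> w \<in> reduced_words A \<Longrightarrow> cancel_cons x w \<in> reduced_words A"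
  using set_cancel_cons[of x w] by (auto simp: reduced_words_def distinct_adj_cancel_cons)

text \<open>Each of the \<open>n\<close> letters after the first only has to avoid its predecessor,
  which leaves \<open>card A - 1\<close> choices.\<close>

lemma card_reduced_words_hd:
  assumes "finite A" "x \<in> A"
  shows "finite {w \<in> reduced_words A. length w = Suc n \<and> hd w = x}"
    and "card {w \<in> reduced_words A. length w = Suc n \<and> hd w = x} = (card A - 1) ^ n"
proof -
  let ?W = "\<lambda>n x. {w \<in> reduced_words A. length w = Suc n \<and> hd w = x}"
  have "finite (?W n x) \<and> card (?W n x) = (card A - 1) ^ n"
    using assms(2)
  proof (induction n arbitrary: x)
    case 0
    then have "?W 0 x = {[x]}"
      by (auto simp: reduced_words_def length_Suc_conv)
    then show ?case by simp
  next
    case (Suc n)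
    have "?W (Suc n) x = (#) x ` (\<Union>y\<in>A - {x}. ?W n y)"
    proof (intro equalityI subsetI)
      fix w assume w: "w \<in> ?W (Suc n) x"
      then obtain y v where "w = x # y # v"
        by (auto simp: length_Suc_conv)
      with w have "y # v \<in> (\<Union>y\<in>A - {x}. ?W n y)"
        by (auto simp: reduced_words_def)
      with \<open>w = x # y # v\<close> show "w \<in> (#) x ` (\<Union>y\<in>A - {x}. ?W n y)"
        by blast
    next
      fix w assume "w \<in> (#) x ` (\<Union>y\<in>A - {x}. ?W n y)"
      then show "w \<in> ?W (Suc n) x"
        using Suc.prems by (auto simp: reduced_words_def distinct_adj_Cons)
    qed
    \<comment> \<open>The sets are disjoint because their words differ in the first letter.\<close>
    moreover have "card (\<Union>y\<in>A - {x}. ?W n y) = (\<Sum>y\<in>A - {x}. card (?W n y))"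
      using assms(1) Suc.IH by (intro card_UN_disjoint) auto
    moreover have "\<dots> = (card A - 1) ^ Suc n"
      using assms(1) Suc by simp
    ultimately show ?case
      using assms(1) Suc.IH by (auto simp: card_image)
  qed
  then show "finite (?W n x)" "card (?W n x) = (card A - 1) ^ n" by auto
qed

section \<open>Words as elements of the free product\<close>

definition Z2_word :: "nat \<Rightarrow> nat list \<Rightarrow> nat word set" where
  "Z2_word s w = word_class {..<s} {[(i, True), (i, True)] | i. i < s} (map (\<lambda>i. (i, True)) w)"

lemma Z2_word_singleton: "Z2_word s [i] = Z2_gen s i"
  by (simp add: Z2_word_def Z2_gen_def)

lemma positive_word_words: "set w \<subseteq> S \<Longrightarrow> map (\<lambda>i. (i, True)) w \<in> words S"
  by (auto simp: words_def)

lemma Z2_word_carrier: "set w \<subseteq> {..<s} \<Longrightarrow> Z2_word s w \<in> carrier (Z2_free_power s)"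
  by (auto simp: Z2_word_def Z2_free_power_def carrier_presented_group intro: positive_word_words)

lemma Z2_word_Nil: "Z2_word s [] = \<one>\<^bsub>Z2_free_power s\<^esub>"
  by (simp add: Z2_word_def Z2_free_power_def one_presented_group)

lemma Z2_word_append:
  assumes "set u \<subseteq> {..<s}" "set v \<subseteq> {..<s}"
  shows "Z2_word s (u @ v) = Z2_word s u \<otimes>\<^bsub>Z2_free_power s\<^esub> Z2_word s v"
  using assms
  by (simp add: Z2_word_def Z2_free_power_def mult_presented_group positive_word_words)

lemma Z2_word_Cons:
  assumes "i < s" "set w \<subseteq> {..<s}"
  shows "Z2_word s (i # w) = Z2_gen s i \<otimes>\<^bsub>Z2_free_power s\<^esub> Z2_word s w"
  using Z2_word_append[of "[i]" s w] assms by (simp add: Z2_word_singleton)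

text \<open>Links the combinatorial action to the group: it is left multiplication by a generator.
  Positive letters suffice because each generator is its own inverse.\<close>

lemma Z2_word_cancel_cons:
  assumes "i < s" "set w \<subseteq> {..<s}"
  shows "Z2_word s (cancel_cons i w) = Z2_gen s i \<otimes>\<^bsub>Z2_free_power s\<^esub> Z2_word s w"
proof -
  let ?R = "{[(i, True), (i, True)] | i. i < s}" and ?p = "map (\<lambda>i. (i, True))"
  have "Z2_word s (i # i # v) = Z2_word s v" if v: "set v \<subseteq> {..<s}" for v
  proof -
    have "pres_eq {..<s} ?R ([(i, True), (i, True)] @ ?p v) ([] @ ?p v)"
      using assms(1) v
      by (intro pres_eq.append pres_eq.relator pres_eq.refl positive_word_words)
        (auto simp: words_def)
    then show ?thesis
      using pres_eq_words[of "{..<s}" ?R] by (simp add: Z2_word_def word_class_eq_iff)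
  qed
  then show ?thesis
    using assms Z2_word_Cons[OF assms]
    by (auto simp: cancel_cons_def split: list.splits)
qed

text \<open>The uniqueness half of the normal form theorem: equal group elements act equally on the
  empty word, and a reduced word sends the empty word to itself.\<close>

lemma Z2_word_inj: "inj_on (Z2_word s) (reduced_words {..<s})"
proof (rule inj_onI)
  \<comment> \<open>Writing the index condition as membership in \<open>{..<s}\<close> matches the
    relator set of \<open>pres_eq_foldr_cancel_cons\<close>.\<close>
  let ?R = "{[(i, True), (i, True)] | i. i \<in> {..<s}}" and ?p = "map (\<lambda>i. (i, True))"
  fix u v assume uv: "u \<in> reduced_words {..<s}" "v \<in> reduced_words {..<s}" "Z2_word s u = Z2_word s v"
  have "pres_eq {..<s} ?R (?p u) (?p v)"
    using uv by (simp add: Z2_word_def reduced_words_def word_class_eq_iff positive_word_words)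
  from pres_eq_foldr_cancel_cons[OF this, of "[]"]
  have "foldr cancel_cons u [] = foldr cancel_cons v []"
    by (simp add: foldr_map comp_def)
  then show "u = v"
    using uv by (simp add: reduced_words_def foldr_cancel_cons_distinct_adj)
qed

section \<open>The shift on words and its orbits\<close>

definition shift_word :: "nat \<Rightarrow> nat \<Rightarrow> nat list \<Rightarrow> nat list" where
  "shift_word s k = map (\<lambda>i. (i + k) mod s)"

lemma set_shift_word: "0 < s \<Longrightarrow> set (shift_word s k w) \<subseteq> {..<s}"
  by (auto simp: shift_word_def)

lemma length_shift_word [simp]: "length (shift_word s k w) = length w"
  by (simp add: shift_word_def)

text \<open>Translation modulo \<open>s\<close> is injective on the letters, so distinct neighbours
  stay distinct.\<close>

lemma shift_word_reduced:
  assumes "w \<in> reduced_words {..<s}"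
  shows "shift_word s k w \<in> reduced_words {..<s}"
proof (cases "s = 0")
  case False
  have "inj_on (\<lambda>i. (i + k) mod s) {..<s}"
  proof (rule inj_onI)
    fix i j assume "i \<in> {..<s}" "j \<in> {..<s}" "(i + k) mod s = (j + k) mod s"
    then have "i mod s = j mod s"
      \<comment> \<open>The congruence becomes an equation of naturals up to multiples of
        \<open>s\<close>, in which \<open>k\<close> cancels.\<close>
      unfolding nat_mod_eq_iff by (auto simp: add.assoc add.commute[of k])
    then show "i = j"
      using \<open>i \<in> {..<s}\<close> \<open>j \<in> {..<s}\<close> by simp
  qed
  then have "inj_on (\<lambda>i. (i + k) mod s) (set w)"
    using assms by (auto simp: reduced_words_def intro: inj_on_subset)
  then show ?thesis
    using assms set_shift_word[of s k w] False
    by (simp add: reduced_words_def shift_word_def distinct_adj_map_iff)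
qed (use assms in \<open>auto simp: reduced_words_def shift_word_def\<close>)

text \<open>Supplies the shift that makes a word with first letter \<open>a\<close> begin with
  \<open>0\<close>, the index of the generator written \<open>a\<^sub>1\<close> above.\<close>

lemma mod_shift_to_zero: "a < s \<Longrightarrow> (a + (s - a) mod s) mod s = (0::nat)"
  by (simp add: mod_simps)

context
  fixes s :: nat and \<phi> :: "nat word set \<Rightarrow> nat word set"
  assumes s: "s \<ge> 1"
    and auto: "\<phi> \<in> auto (Z2_free_power s)"
    and shift: "\<And>i. i < s \<Longrightarrow> \<phi> (Z2_gen s i) = Z2_gen s ((i + 1) mod s)"
begin

interpretation group "Z2_free_power s"
  by (simp add: Z2_free_power_def group_presented_group)

abbreviation (input) word_orbit :: "nat list \<Rightarrow> nat word set set" where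
  "word_orbit w \<equiv> aut_proj (Z2_free_power s) \<phi> (Z2_word s w)"

lemma ord_pos: "group.ord (AutoGroup (Z2_free_power s)) \<phi> > 0"
  using Z2_shift_ord[OF s auto shift] s by simp

lemma shift_pow_Z2_word:
  assumes "set w \<subseteq> {..<s}"
  shows "(\<phi> [^]\<^bsub>AutoGroup (Z2_free_power s)\<^esub> (k::nat)) (Z2_word s w) = Z2_word s (shift_word s k w)"
proof -
  let ?f = "\<phi> [^]\<^bsub>AutoGroup (Z2_free_power s)\<^esub> k"
  have f: "?f \<in> hom (Z2_free_power s) (Z2_free_power s)"
    using auto_pow_closed[OF auto, of k] by (simp add: auto_def)
  from assms show ?thesis
  proof (induction w)
    case Nil
    then show ?case
      using hom_one[OF f is_group is_group] by (simp add: Z2_word_Nil shift_word_def)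
  next
    case (Cons i w)
    have i: "i < s" and w: "set w \<subseteq> {..<s}" using Cons.prems by auto
    have carr: "Z2_gen s i \<in> carrier (Z2_free_power s)" "Z2_word s w \<in> carrier (Z2_free_power s)"
      using Z2_gen_carrier[OF s auto shift i] Z2_word_carrier[OF w] by auto
    have "?f (Z2_word s (i # w)) = ?f (Z2_gen s i) \<otimes>\<^bsub>Z2_free_power s\<^esub> ?f (Z2_word s w)"
      unfolding Z2_word_Cons[OF i w] by (rule hom_mult[OF f carr])
    also have "\<dots> = Z2_gen s ((i + k) mod s) \<otimes>\<^bsub>Z2_free_power s\<^esub> Z2_word s (shift_word s k w)"
      using Z2_shift_pow[OF s auto shift i] Cons.IH[OF w] by simp
    also have "\<dots> = Z2_word s (shift_word s k (i # w))"
      using Z2_word_Cons[of "(i + k) mod s" s "shift_word s k w"] s set_shift_word[of s k w]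
      by (simp add: shift_word_def)
    finally show ?case .
  qed
qed

lemma word_orbit_shift:
  assumes "set w \<subseteq> {..<s}"
  shows "word_orbit (shift_word s k w) = word_orbit w"
  using aut_proj_pow[OF auto ord_pos Z2_word_carrier[OF assms], of k]
  by (simp add: shift_pow_Z2_word[OF assms])

text \<open>An orbit consists of the elements given by the shifts of one word; uniqueness of normal
  forms lifts equality of elements to equality of words.\<close>

lemma word_orbit_eqD:
  assumes "u \<in> reduced_words {..<s}" "v \<in> reduced_words {..<s}" "word_orbit u = word_orbit v"
  obtains k where "v = shift_word s k u"
proof -
  have sub: "set u \<subseteq> {..<s}" "set v \<subseteq> {..<s}"
    using assms by (auto simp: reduced_words_def)
  have orb: "word_orbit w = range (\<lambda>k. Z2_word s (shift_word s k w))" if "set w \<subseteq> {..<s}" for w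
    unfolding aut_proj_eq[OF auto ord_pos Z2_word_carrier[OF that]]
    by (simp add: shift_pow_Z2_word[OF that])
  have "shift_word s 0 v = v"
    using sub by (auto simp: shift_word_def intro!: map_idI)
  then have "Z2_word s v \<in> word_orbit v"
    unfolding orb[OF sub(2)] by (metis rangeI)
  then obtain k where "Z2_word s v = Z2_word s (shift_word s k u)"
    unfolding assms(3)[symmetric] orb[OF sub(1)] by blast
  then have "v = shift_word s k u"
    using inj_onD[OF Z2_word_inj] assms shift_word_reduced by blast
  then show ?thesis using that by blast
qed

section \<open>Powers of the generator orbit\<close>

lemma word_orbit_singleton: "i < s \<Longrightarrow> word_orbit [i] = {Z2_gen s j | j. j < s}"
  using Z2_gen_orbit[OF s auto shift] by (simp add: Z2_word_singleton)

text \<open>The product may be computed with any representatives; here generator \<open>0\<close>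
  represents its orbit, and \<open>\<phi>\<close> acts on the other factor by shifting
  \<open>w\<close>.\<close>

lemma nv_mult_generator_orbit:
  assumes w: "set w \<subseteq> {..<s}"
  shows "nv_mult (coset_group (Z2_free_power s) \<phi>) {Z2_gen s i | i. i < s} (word_orbit w) =
    image_mset (\<lambda>k. word_orbit (cancel_cons 0 (shift_word s k w))) (mset_set {0..<s})"
proof -
  have s0: "0 < s" using s by simp
  have "Z2_word s (cancel_cons 0 (shift_word s k w)) =
      Z2_word s [0] \<otimes>\<^bsub>Z2_free_power s\<^esub> (\<phi> [^]\<^bsub>AutoGroup (Z2_free_power s)\<^esub> k) (Z2_word s w)" for k
    using Z2_word_cancel_cons[OF s0 set_shift_word[OF s0]]
    by (simp add: shift_pow_Z2_word[OF w] Z2_word_singleton)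
  then show ?thesis
    using coset_group_mult[OF auto ord_pos Z2_word_carrier[of "[0]"] Z2_word_carrier[OF w]] s0
    by (simp add: Z2_shift_ord[OF s auto shift] word_orbit_singleton[OF s0])
qed

text \<open>Multiplication by a generator lengthens a reduced word by at most one letter.
  Cancellation can produce shorter words, hence only a bound on the length.\<close>

lemma nv_pow_subset:
  "set_mset (nv_pow (coset_group (Z2_free_power s) \<phi>) {Z2_gen s i | i. i < s} (Suc n)) \<subseteq>
    word_orbit ` {w \<in> reduced_words {..<s}. length w \<le> Suc n}"
proof (induction n)
  case 0
  have "{Z2_gen s i | i. i < s} = word_orbit [0]"
    using s by (simp add: word_orbit_singleton)
  moreover have "[0] \<in> {w \<in> reduced_words {..<s}. length w \<le> Suc 0}"
    using s by (simp add: reduced_words_def)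
  ultimately show ?case by auto
next
  case (Suc n)
  show ?case
  proof
    fix y assume "y \<in># nv_pow (coset_group (Z2_free_power s) \<phi>) {Z2_gen s i | i. i < s} (Suc (Suc n))"
    then obtain x where
      x: "x \<in># nv_pow (coset_group (Z2_free_power s) \<phi>) {Z2_gen s i | i. i < s} (Suc n)" and
      y: "y \<in># nv_mult (coset_group (Z2_free_power s) \<phi>) {Z2_gen s i | i. i < s} x"
      by auto
    from x Suc.IH obtain w where w: "x = word_orbit w" "w \<in> reduced_words {..<s}" "length w \<le> Suc n"
      by blast
    have "set w \<subseteq> {..<s}" using w(2) by (simp add: reduced_words_def)
    from y[unfolded w(1) nv_mult_generator_orbit[OF this]]
    obtain k where k: "y = word_orbit (cancel_cons 0 (shift_word s k w))"
      by auto
    have "cancel_cons 0 (shift_word s k w) \<in> reduced_words {..<s}"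
      using s w(2) by (intro cancel_cons_reduced_words shift_word_reduced) auto
    moreover have "length (cancel_cons 0 (shift_word s k w)) \<le> Suc (Suc n)"
      using length_cancel_cons[of 0 "shift_word s k w"] w(3) by simp
    ultimately show "y \<in> word_orbit ` {w \<in> reduced_words {..<s}. length w \<le> Suc (Suc n)}"
      unfolding k by blast
  qed
qed

text \<open>Dropping the first letter gives an orbit in the previous power. Shifting so that the
  dropped letter is \<open>0\<close> lets the product restore it.\<close>

lemma word_orbit_in_nv_pow:
  assumes "w \<in> reduced_words {..<s}" "length w = Suc n"
  shows "word_orbit w \<in># nv_pow (coset_group (Z2_free_power s) \<phi>) {Z2_gen s i | i. i < s} (Suc n)"
  using assms
proof (induction n arbitrary: w)
  case 0
  then obtain i where "w = [i]" "i < s"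
    by (auto simp: length_Suc_conv reduced_words_def)
  then show ?case by (simp add: word_orbit_singleton)
next
  case (Suc n)
  then obtain a v where w: "w = a # v" and len: "length v = Suc n"
    by (auto simp: length_Suc_conv)
  have a: "a < s" and v: "v \<in> reduced_words {..<s}" "set v \<subseteq> {..<s}"
    using Suc.prems w by (auto simp: reduced_words_def distinct_adj_Cons)
  \<comment> \<open>For \<open>a = 0\<close> the reduction modulo \<open>s\<close> gives
    \<open>0\<close>, so \<open>?k\<close> is always one of the indices in
    \<open>{0..<s}\<close>.\<close>
  let ?k = "(s - a) mod s"
  have sw: "shift_word s ?k w = 0 # shift_word s ?k v"
    using mod_shift_to_zero[OF a] by (simp add: w shift_word_def)
  moreover have "distinct_adj (shift_word s ?k w)"
    using shift_word_reduced[OF Suc.prems(1)] by (simp add: reduced_words_def)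
  \<comment> \<open>The shift of \<open>w\<close> is reduced, so the shift of \<open>v\<close> does
    not begin with \<open>0\<close> and nothing cancels.\<close>
  ultimately have "cancel_cons 0 (shift_word s ?k v) = shift_word s ?k w"
    by (auto simp: cancel_cons_def distinct_adj_Cons split: list.splits)
  then have "word_orbit w = word_orbit (cancel_cons 0 (shift_word s ?k v))"
    using word_orbit_shift Suc.prems(1) by (simp add: reduced_words_def)
  then have "word_orbit w \<in># nv_mult (coset_group (Z2_free_power s) \<phi>) {Z2_gen s i | i. i < s} (word_orbit v)"
    unfolding nv_mult_generator_orbit[OF v(2)] using s by auto
  then show ?case
    using Suc.IH[OF v(1) len] by auto
qed

text \<open>The orbits reached are represented exactly once by the words in \<open>?T\<close>: the
  empty word and, for each \<open>m < k\<close>, the reduced words of length \<open>m + 1\<close>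
  beginning with \<open>0\<close>.\<close>

lemma nv_growth_eq_sum:
  "nv_growth (coset_group (Z2_free_power s) \<phi>) {Z2_gen s i | i. i < s} k = 1 + (\<Sum>m<k. (s - 1) ^ m)"
proof -
  let ?N = "coset_group (Z2_free_power s) \<phi>" and ?g = "{Z2_gen s i | i. i < s}"
  let ?W = "\<lambda>m. {w \<in> reduced_words {..<s}. length w = Suc m \<and> hd w = 0}"
  let ?T = "insert [] (\<Union>m<k. ?W m)"
  have unit: "nv_unit ?N = word_orbit []"
    by (simp add: coset_group_def Z2_word_Nil)
  have "{nv_unit ?N} \<union> (\<Union>j\<in>{1..k}. set_mset (nv_pow ?N ?g j)) = word_orbit ` ?T"
  proof (intro equalityI subsetI)
    fix x assume x: "x \<in> {nv_unit ?N} \<union> (\<Union>j\<in>{1..k}. set_mset (nv_pow ?N ?g j))"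
    \<comment> \<open>Any reduced representative of length at most \<open>k\<close> will do; a shift
      then moves it into \<open>?T\<close>.\<close>
    have "\<exists>w \<in> reduced_words {..<s}. length w \<le> k \<and> x = word_orbit w"
    proof (cases "x = nv_unit ?N")
      case True
      then show ?thesis
        using unit by (intro bexI[of _ "[]"]) (auto simp: reduced_words_def)
    next
      case False
      with x obtain j where "j \<in> {1..k}" "x \<in># nv_pow ?N ?g j" by blast
      then obtain n where "Suc n \<le> k" "x \<in># nv_pow ?N ?g (Suc n)"
        by (cases j) auto
      then obtain w where "w \<in> reduced_words {..<s}" "length w \<le> Suc n" "x = word_orbit w"
        using nv_pow_subset by blast
      with \<open>Suc n \<le> k\<close> show ?thesis
        by (intro bexI[of _ w] conjI) auto
    qed
    then obtain w where w: "w \<in> reduced_words {..<s}" "length w \<le> k" "x = word_orbit w" by blast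
    show "x \<in> word_orbit ` ?T"
    proof (cases w)
      case Nil
      with w show ?thesis by blast
    next
      case (Cons a v)
      let ?u = "shift_word s ((s - a) mod s) w"
      have "a < s" using w Cons by (simp add: reduced_words_def)
      then have "hd ?u = 0"
        using mod_shift_to_zero Cons by (simp add: shift_word_def)
      then have "?u \<in> ?W (length v)"
        using shift_word_reduced[OF w(1)] Cons by simp
      moreover have "length v < k" using w Cons by simp
      moreover have "word_orbit ?u = x"
        using w word_orbit_shift by (simp add: reduced_words_def)
      ultimately show ?thesis by blast
    qed
  next
    fix x assume "x \<in> word_orbit ` ?T"
    then consider "x = word_orbit []" | m w where "m < k" "w \<in> ?W m" "x = word_orbit w"
      by blast
    then show "x \<in> {nv_unit ?N} \<union> (\<Union>j\<in>{1..k}. set_mset (nv_pow ?N ?g j))"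
    proof cases
      case 1
      then show ?thesis using unit by simp
    next
      case (2 m w)
      then have "x \<in># nv_pow ?N ?g (Suc m)"
        using word_orbit_in_nv_pow by simp
      moreover have "Suc m \<in> {1..k}" using 2 by simp
      ultimately show ?thesis by blast
    qed
  qed
  moreover have "inj_on word_orbit ?T"
  proof (rule inj_onI)
    fix u v assume u: "u \<in> ?T" and v: "v \<in> ?T" and eq: "word_orbit u = word_orbit v"
    have r: "u \<in> reduced_words {..<s}" "v \<in> reduced_words {..<s}"
      using u v by (auto simp: reduced_words_def)
    from word_orbit_eqD[OF r eq] obtain j where j: "v = shift_word s j u" .
    show "u = v"
    proof (cases u)
      case Nil
      then show ?thesis using j by (simp add: shift_word_def)
    next
      case (Cons a w)
      then have "a = 0" using u by auto
      moreover have "hd v = 0" using v j Cons by (auto simp: shift_word_def)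
      \<comment> \<open>Both words begin with \<open>0\<close>, so the shift relating them is by a
        multiple of \<open>s\<close> and fixes every letter.\<close>
      ultimately have "j mod s = 0" using j Cons by (simp add: shift_word_def)
      then have "(i + j) mod s = i" if "i < s" for i
        using that by (metis add.right_neutral mod_add_right_eq mod_less)
      then show ?thesis
        using r(1) j by (auto simp: reduced_words_def shift_word_def intro!: map_idI[symmetric])
    qed
  qed
  ultimately have "nv_growth ?N ?g k = card ?T"
    unfolding nv_growth_def by (simp only: card_image)
  also have "\<dots> = 1 + card (\<Union>m<k. ?W m)"
    using card_reduced_words_hd(1)[of "{..<s}" 0] s by (subst card_insert_disjoint) auto
  also have "card (\<Union>m<k. ?W m) = (\<Sum>m<k. card (?W m))"
    using card_reduced_words_hd(1)[of "{..<s}" 0] s by (intro card_UN_disjoint) auto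
  also have "\<dots> = (\<Sum>m<k. (s - 1) ^ m)"
    using card_reduced_words_hd(2)[of "{..<s}" 0] s by simp
  finally show ?thesis .
qed

end

section \<open>Closed formula and type of growth\<close>

text \<open>The quotient of any bound \<open>C * (k + 1) powr d\<close> by \<open>2 ^ k\<close>
  tends to \<open>0\<close>, so the bound eventually drops below \<open>2 ^ k\<close>.\<close>

lemma not_polynomial_growth_if_ge_power2:
  assumes "\<And>k. 2 ^ k \<le> \<xi> k"
  shows "\<not> polynomial_growth \<xi>"
proof
  assume "polynomial_growth \<xi>"
  then obtain C d :: real where bound: "\<And>k. real (\<xi> k) \<le> C * (real k + 1) powr d"
    unfolding polynomial_growth_def by blast
  have "((\<lambda>k::nat. C * (real k + 1) powr d / 2 ^ k) \<longlongrightarrow> 0) sequentially"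
    by real_asymp
  then have "eventually (\<lambda>k::nat. C * (real k + 1) powr d / 2 ^ k < 1) sequentially"
    by (rule order_tendstoD) simp
  then obtain k :: nat where "C * (real k + 1) powr d / 2 ^ k < 1"
    by (auto simp: eventually_sequentially)
  moreover have "2 ^ k \<le> real (\<xi> k)"
    using assms[of k] by (metis of_nat_le_iff of_nat_numeral of_nat_power)
  ultimately show False
    using bound[of k] by (simp add: divide_simps)
qed

theorem proposition3:
  fixes s :: nat and \<phi> :: "nat word set \<Rightarrow> nat word set"
  assumes "s \<ge> 2"
    and "\<phi> \<in> auto (Z2_free_power s)"
    and "\<And>i. i < s \<Longrightarrow> \<phi> (Z2_gen s i) = Z2_gen s ((i + 1) mod s)"
  shows "(\<forall>k. real (nv_growth (coset_group (Z2_free_power s) \<phi>) {Z2_gen s i | i. i < s} k) =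
           (if s \<ge> 3 then ((real s - 1) ^ k - 1) / (real s - 2) + 1 else real k + 1)) \<and>
         (polynomial_growth (nv_growth (coset_group (Z2_free_power s) \<phi>) {Z2_gen s i | i. i < s})
           \<longleftrightarrow> s = 2)"
proof -
  let ?\<xi> = "nv_growth (coset_group (Z2_free_power s) \<phi>) {Z2_gen s i | i. i < s}"
  have \<xi>: "?\<xi> k = 1 + (\<Sum>m<k. (s - 1) ^ m)" for k
    using assms by (intro nv_growth_eq_sum) auto
  have formula: "real (?\<xi> k) =
      (if s \<ge> 3 then ((real s - 1) ^ k - 1) / (real s - 2) + 1 else real k + 1)" for k
  \<comment> \<open>The geometric sum has ratio \<open>s - 1\<close>; for \<open>s = 2\<close> the
    ratio is \<open>1\<close> and all summands are \<open>1\<close>.\<close>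
  proof (cases "s \<ge> 3")
    case True
    have "real (?\<xi> k) = 1 + (\<Sum>m<k. (real s - 1) ^ m)"
      using assms(1) by (simp add: \<xi> of_nat_diff)
    then show ?thesis
      using True by (simp add: geometric_sum)
  next
    case False
    then have "s = 2" using assms(1) by simp
    then show ?thesis unfolding \<xi> by simp
  qed
  moreover have "polynomial_growth ?\<xi> \<longleftrightarrow> s = 2"
  proof
    assume "s = 2"
    \<comment> \<open>Both constants \<open>C\<close> and \<open>d\<close> are taken to be
      \<open>1\<close>.\<close>
    then show "polynomial_growth ?\<xi>"
      unfolding polynomial_growth_def \<xi> by (intro exI[of _ 1]) simp
  next
    assume pg: "polynomial_growth ?\<xi>"
    show "s = 2"
    proof (rule ccontr)
      assume "s \<noteq> 2"
      then have "2 \<le> s - 1" using assms(1) by simp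
      have "2 ^ k \<le> ?\<xi> k" for k
      proof -
        \<comment> \<open>The power of two is the same sum with ratio \<open>2\<close>, so it can be
          compared term by term with ratio \<open>s - 1\<close>.\<close>
        have "(2::nat) ^ k = 1 + (\<Sum>m<k. 2 ^ m)"
          by (induction k) auto
        also have "\<dots> \<le> 1 + (\<Sum>m<k. (s - 1) ^ m)"
          using \<open>2 \<le> s - 1\<close> by (intro add_left_mono sum_mono power_mono) auto
        finally show ?thesis unfolding \<xi> .
      qed
      with pg show False
        using not_polynomial_growth_if_ge_power2 by blast
    qed
  qed
  ultimately show ?thesis by blast
qed

end
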